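(* The family of connected chordal graphs admitting a tree representation $T$ such that $T$ is a subdivided star is Gallai; that is, every connected chordal graph $G$ that has a tree representation whose host tree is a subdivision of a star contains a vertex belonging to every longest path of $G$.
   Context: All graphs are finite and simple. A graph is chordal if each of its cycles on at least $4$ vertices has a chord. A tree representation of a chordal graph $G$ consists of a tree $T$ (the host tree) together with a (nonempty, connected) subtree $S(u)$ of $T$ for each $u\in V(G)$, such that distinct $u,v\in V(G)$ are adjacent in $G$ if and only if $S(u)$ and $S(v)$ share a vertex. A star is a complete bipartite graph $K_{1,m}$; a subdivision of a graph is obtained by a sequence of zero or more edge subdivisions (replacing an edge $uv$ by a path of length $2$ from $u$ to $v$ through a new vertex). A family of graphs is Gallai if each connected graph in it has a vertex belonging to every longest path of that graph. *)

theory Defs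
  imports "Graph_Theory.Graph_Theory"
begin

text \<open>
  A finite simple graph is a \<^locale>\<open>pair_graph\<close>: finite vertex set, no loops, and each undirected
  edge \<open>uv\<close> present as the two arcs \<open>(u,v)\<close> and \<open>(v,u)\<close>. The library predicate \<^const>\<open>connected\<close>
  includes nonemptiness of the vertex set.
\<close>

text \<open>
  \<^const>\<open>pre_digraph.cycle\<close> also accepts the closed walk \<open>u, v, u\<close> along a single edge. Length at
  least 3 excludes it; since vertices do not repeat, the length is the number of vertices of the cycle.
  For the same reason \<^const>\<open>forest\<close> and \<^const>\<open>tree\<close> of the library are not the undirected notions
  on symmetric digraphs (they admit no edge at all), so trees are defined here.
\<close>
definition undirected_cycle :: "'a pair_pre_digraph \<Rightarrow> ('a \<times> 'a) awalk \<Rightarrow> bool" where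
  "undirected_cycle G c \<longleftrightarrow> pre_digraph.cycle (with_proj G) c \<and> length c \<ge> 3"

definition tree_graph :: "'a pair_pre_digraph \<Rightarrow> bool" where
  "tree_graph T \<longleftrightarrow> pair_graph T \<and> connected (with_proj T) \<and> \<not> (\<exists>c. undirected_cycle T c)"

text \<open>A chord of a cycle: an edge between two of its vertices that is not an edge of the cycle.\<close>
definition chord :: "'a pair_pre_digraph \<Rightarrow> ('a \<times> 'a) awalk \<Rightarrow> 'a \<Rightarrow> 'a \<Rightarrow> bool" where
  "chord G c x y \<longleftrightarrow> x \<in> fst ` set c \<and> y \<in> fst ` set c \<and>
     (x, y) \<in> parcs G \<and> (x, y) \<notin> set c \<and> (y, x) \<notin> set c"

definition chordal :: "'a pair_pre_digraph \<Rightarrow> bool" where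
  "chordal G \<longleftrightarrow> (\<forall>c. undirected_cycle G c \<and> length c \<ge> 4 \<longrightarrow> (\<exists>x y. chord G c x y))"

definition subtree :: "'a pair_pre_digraph \<Rightarrow> 'a pair_pre_digraph \<Rightarrow> bool" where
  "subtree S T \<longleftrightarrow> subgraph (with_proj S) (with_proj T) \<and> tree_graph S"

definition tree_representation ::
  "'a pair_pre_digraph \<Rightarrow> 'b pair_pre_digraph \<Rightarrow> ('a \<Rightarrow> 'b pair_pre_digraph) \<Rightarrow> bool" where
  "tree_representation G T S \<longleftrightarrow> tree_graph T \<and> (\<forall>u \<in> pverts G. subtree (S u) T) \<and>
     (\<forall>u \<in> pverts G. \<forall>v \<in> pverts G. u \<noteq> v \<longrightarrow>
        ((u, v) \<in> parcs G \<longleftrightarrow> pverts (S u) \<inter> pverts (S v) \<noteq> {}))"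

text \<open>The case \<open>m = 0\<close>, a single vertex, counts as a star.\<close>
definition star_graph :: "'a pair_pre_digraph \<Rightarrow> bool" where
  "star_graph K \<longleftrightarrow> (\<exists>m. K\<^bsub>1,m\<^esub> (with_proj K))"

definition subdivided_star :: "'a pair_pre_digraph \<Rightarrow> bool" where
  "subdivided_star T \<longleftrightarrow> (\<exists>K. star_graph K \<and> subdivision_pair K T)"

definition longest_path :: "'a pair_pre_digraph \<Rightarrow> 'a vwalk \<Rightarrow> bool" where
  "longest_path G p \<longleftrightarrow> vpath p (with_proj G) \<and>
     (\<forall>q. vpath q (with_proj G) \<longrightarrow> vwalk_length q \<le> vwalk_length p)"

definition gallai :: "'a pair_pre_digraph set \<Rightarrow> bool" where
  "gallai F \<longleftrightarrow> (\<forall>G \<in> F. connected (with_proj G) \<longrightarrow>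
     (\<exists>v \<in> pverts G. \<forall>p. longest_path G p \<longrightarrow> v \<in> set p))"

end

theory Submission
  imports Defs
begin

text \<open>
  A vertex outside a longest path is adjacent neither to an end of the path nor to two consecutive
  vertices of it. If all longest paths meet the bag of the centre of the host tree, compare their
  initial segments outside this bag with a longest such segment, lying in a leg \<open>i\<close>: the central
  vertex whose subtree reaches furthest into leg \<open>i\<close> is on every longest path. Otherwise some longest
  path lies in a single leg; as longest paths pairwise intersect, all of them meet the bag of some node
  of that leg, and if this node is chosen closest to the centre, the vertex of its bag reaching furthest
  outwards is on every longest path.
\<close>

section \<open>Extremal elements of finite sets\<close>

lemma finite_maximizer:
  fixes f :: "'a \<Rightarrow> 'b::linorder"
  assumes "finite A" "A \<noteq> {}"
  obtains x where "x \<in> A" "\<And>y. y \<in> A \<Longrightarrow> f y \<le> f x"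
proof -
  have "Max (f ` A) \<in> f ` A"
    using assms by (intro Max_in) auto
  then obtain x where "x \<in> A" "f x = Max (f ` A)"
    by force
  then show thesis
    using assms that by simp
qed

lemma finite_minimizer:
  fixes f :: "'a \<Rightarrow> 'b::linorder"
  assumes "finite A" "A \<noteq> {}"
  obtains x where "x \<in> A" "\<And>y. y \<in> A \<Longrightarrow> f x \<le> f y"
proof -
  have "Min (f ` A) \<in> f ` A"
    using assms by (intro Min_in) auto
  then obtain x where "x \<in> A" "f x = Min (f ` A)"
    by force
  then show thesis
    using assms that by simp
qed

section \<open>Longest paths in connected graphs\<close>

locale connected_simple_graph =
  fixes V :: "'a set" and E :: "'a \<Rightarrow> 'a \<Rightarrow> bool"
  assumes finite_V: "finite V"
    and E_sym: "E u v \<Longrightarrow> E v u"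
    and E_in_V: "E u v \<Longrightarrow> u \<in> V"
    and linked: "\<lbrakk>u \<in> V; v \<in> V\<rbrakk> \<Longrightarrow>
      \<exists>p. p \<noteq> [] \<and> distinct p \<and> set p \<subseteq> V \<and> successively E p \<and> hd p = u \<and> last p = v"
begin

definition path :: "'a list \<Rightarrow> bool" where
  "path p \<longleftrightarrow> p \<noteq> [] \<and> distinct p \<and> set p \<subseteq> V \<and> successively E p"

definition longest :: "'a list \<Rightarrow> bool" where
  "longest p \<longleftrightarrow> path p \<and> (\<forall>q. path q \<longrightarrow> length q \<le> length p)"

lemma E_sym_iff: "E u v \<longleftrightarrow> E v u"
  using E_sym by blast

lemma path_rev [simp]: "path (rev p) \<longleftrightarrow> path p"
proof -
  have "(\<lambda>x y. E y x) = E"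
    by (intro ext) (rule E_sym_iff)
  then show ?thesis
    by (simp add: path_def cong del: successively_cong)
qed

lemma path_append:
  assumes "path p" "path q" "set p \<inter> set q = {}" "E (last p) (hd q)"
  shows "path (p @ q)"
  using assms unfolding path_def by (auto simp: successively_append_iff)

lemma path_Cons:
  assumes "path p" "v \<notin> set p" "E v (hd p)"
  shows "path (v # p)"
  using assms E_in_V unfolding path_def by (auto simp: successively_Cons)

lemma path_appendD1: "path (p @ q) \<Longrightarrow> p \<noteq> [] \<Longrightarrow> path p"
  unfolding path_def by (auto simp: successively_append_iff)

lemma path_appendD2: "path (p @ q) \<Longrightarrow> q \<noteq> [] \<Longrightarrow> path q"
  unfolding path_def by (auto simp: successively_append_iff)

lemma path_adj:
  assumes "path (p @ q)" "p \<noteq> []" "q \<noteq> []"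
  shows "E (last p) (hd q)"
  using assms unfolding path_def by (auto simp: successively_append_iff)

lemma path_length_le: "path p \<Longrightarrow> length p \<le> card V"
  unfolding path_def by (metis card_mono distinct_card finite_V)

lemma longest_path: "longest p \<Longrightarrow> path p"
  by (simp add: longest_def)

lemma longest_length: "longest p \<Longrightarrow> path q \<Longrightarrow> length q \<le> length p"
  by (simp add: longest_def)

lemma longest_rev [simp]: "longest (rev p) \<longleftrightarrow> longest p"
  unfolding longest_def by simp

lemma longest_subset: "longest p \<Longrightarrow> set p \<subseteq> V"
  by (simp add: longest_def path_def)

lemma longest_nonempty: "longest p \<Longrightarrow> p \<noteq> []"
  by (simp add: longest_def path_def)

lemma longest_hd:
  assumes "longest p" "v \<notin> set p"
  shows "\<not> E v (hd p)"
  using path_Cons[OF longest_path] longest_length[OF assms(1)] assms by fastforce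

lemma longest_last:
  assumes "longest p" "v \<notin> set p"
  shows "\<not> E v (last p)"
  using longest_hd[of "rev p" v] assms by (simp add: hd_rev)

text \<open>A vertex adjacent to both could be inserted between \<open>p\<close> and
  \<open>q\<close>, giving a longer path.\<close>

lemma longest_consecutive:
  assumes "longest (p @ q)" "v \<notin> set (p @ q)" "p \<noteq> []" "q \<noteq> []" "E v (last p)"
  shows "\<not> E v (hd q)"
proof
  assume "E v (hd q)"
  have pq: "path (p @ q)"
    using assms(1) by (rule longest_path)
  have "path (v # q)"
    using path_appendD2[OF pq] assms \<open>E v (hd q)\<close> by - (rule path_Cons, auto)
  then have "path (p @ v # q)"
    using path_appendD1[OF pq] assms pq E_sym[OF assms(5)]
    by - (rule path_append, auto simp: path_def)
  then show False
    using longest_length[OF assms(1)] by fastforce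
qed

section \<open>Changes of a property along a path\<close>

lemma switch:
  assumes "a \<in> set p" "b \<in> set p" "\<Phi> a \<noteq> \<Phi> b"
  obtains q r where "p = q @ r" "q \<noteq> []" "r \<noteq> []" "\<Phi> (last q) \<noteq> \<Phi> (hd r)"
proof -
  have "\<exists>q r. p = q @ r \<and> q \<noteq> [] \<and> r \<noteq> [] \<and> \<Phi> (last q) \<noteq> \<Phi> (hd r)"
    if "\<exists>a\<in>set p. \<exists>b\<in>set p. \<Phi> a \<noteq> \<Phi> b"
    using that
  proof (induction p)
    case (Cons x p)
    show ?case
    proof (cases "p \<noteq> [] \<and> \<Phi> x \<noteq> \<Phi> (hd p)")
      case True
      then show ?thesis by (intro exI[of _ "[x]"] exI[of _ p]) auto
    next
      case False
      then have "\<exists>a\<in>set p. \<exists>b\<in>set p. \<Phi> a \<noteq> \<Phi> b"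
        using Cons.prems by (cases p) auto
      then obtain q r where "p = q @ r" "q \<noteq> []" "r \<noteq> []" "\<Phi> (last q) \<noteq> \<Phi> (hd r)"
        using Cons.IH by blast
      then show ?thesis by (intro exI[of _ "x # q"] exI[of _ r]) auto
    qed
  qed simp
  then show thesis using assms that by blast
qed

text \<open>By symmetry of \<open>E\<close> the pair can be oriented so that \<open>\<Phi>\<close>
  holds at \<open>x\<close>, whichever of \<open>a\<close> and \<open>b\<close> comes first on
  \<open>p\<close>.\<close>

lemma path_switch:
  assumes "path p" "a \<in> set p" "b \<in> set p" "\<Phi> a" "\<not> \<Phi> b"
  obtains x y where "x \<in> set p" "y \<in> set p" "E x y" "\<Phi> x" "\<not> \<Phi> y"
proof -
  obtain q r where qr: "p = q @ r" "q \<noteq> []" "r \<noteq> []" "\<Phi> (last q) \<noteq> \<Phi> (hd r)"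
    using switch[of a p b \<Phi>] assms by metis
  then have "E (last q) (hd r)"
    using path_adj assms(1) by blast
  moreover have "last q \<in> set p" "hd r \<in> set p"
    using qr by auto
  ultimately show thesis
    using qr(4) that[of "last q" "hd r"] that[of "hd r" "last q"] E_sym by blast
qed

lemma path_invariant:
  assumes "path p" "a \<in> set p" "b \<in> set p" "\<Phi> a"
    and "\<And>x y. \<lbrakk>x \<in> set p; y \<in> set p; E x y; \<Phi> x\<rbrakk> \<Longrightarrow> \<Phi> y"
  shows "\<Phi> b"
  using path_switch[of p a b \<Phi>] assms by metis

text \<open>The pair at which \<open>\<Phi>\<close> changes is consecutive on \<open>p\<close>, so
  \<open>v\<close> cannot be adjacent to both.\<close>

lemma longest_switch:
  assumes "longest p" "v \<notin> set p" "a \<in> set p" "b \<in> set p" "\<Phi> a" "\<not> \<Phi> b"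
  obtains x y where "x \<in> set p" "y \<in> set p" "E x y" "\<Phi> x" "\<not> \<Phi> y" "\<not> (E v x \<and> E v y)"
proof -
  obtain q r where qr: "p = q @ r" "q \<noteq> []" "r \<noteq> []" "\<Phi> (last q) \<noteq> \<Phi> (hd r)"
    using switch[of a p b \<Phi>] assms by metis
  then have "E (last q) (hd r)"
    using path_adj assms(1) longest_path by blast
  moreover have "last q \<in> set p" "hd r \<in> set p"
    using qr by auto
  moreover have "\<not> (E v (last q) \<and> E v (hd r))"
    using longest_consecutive[of q r v] assms qr by blast
  ultimately show thesis
    using qr(4) that[of "last q" "hd r"] that[of "hd r" "last q"] E_sym by blast
qed

text \<open>Take the successor of \<open>x\<close> on \<open>p\<close>; it exists because the last
  vertex is no neighbour of \<open>v\<close>.\<close>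

lemma longest_neighbour:
  assumes "longest p" "v \<notin> set p" "x \<in> set p" "E v x"
  obtains y where "y \<in> set p" "E x y" "\<not> E v y"
proof -
  obtain q r where p: "p = q @ x # r"
    using split_list[OF assms(3)] by blast
  have "r \<noteq> []"
    using longest_last[OF assms(1,2)] assms(4) p by auto
  moreover have "E x (hd r)"
    using path_adj[of "q @ [x]" r] longest_path[OF assms(1)] p \<open>r \<noteq> []\<close> by auto
  moreover have "\<not> E v (hd r)"
    using longest_consecutive[of "q @ [x]" r v] assms p \<open>r \<noteq> []\<close> by auto
  ultimately show thesis using that[of "hd r"] p by auto
qed

lemma longest_exists:
  assumes "V \<noteq> {}"
  obtains p where "longest p"
proof -
  obtain v where "v \<in> V" using assms by blast
  then have "path [v]" by (simp add: path_def)
  then show thesis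
    using ex_has_greatest_nat[of path "[v]" length "Suc (card V)"] path_length_le that
    unfolding longest_def by (metis less_Suc_eq_le)
qed

section \<open>Pairwise intersection of longest paths\<close>

text \<open>Of the two pieces of \<open>p\<close> ending at \<open>x\<close>, keep the longer. Both
  contain \<open>x\<close>, which makes the bound strict.\<close>

lemma half_path:
  assumes "path p" "x \<in> set p"
  obtains q where "path q" "last q = x" "set q \<subseteq> set p" "length p < 2 * length q"
proof -
  obtain a b where p: "p = a @ x # b"
    using split_list[OF assms(2)] by blast
  have *: "path (a @ [x])" "path (x # b)"
    using path_appendD1[of "a @ [x]" b] path_appendD2[of a "x # b"] assms(1) p by auto
  show thesis
  proof (cases "length a \<le> length b")
    case True
    show thesis by (rule that[of "rev (x # b)"]) (use * True p in \<open>auto simp del: rev.simps\<close>, auto)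
  next
    case False
    show thesis by (rule that[of "a @ [x]"]) (use * False p in auto)
  qed
qed

text \<open>If they were disjoint, more than half of \<open>p\<close>, a shortest connection and
  more than half of \<open>q\<close> would form a path longer than either.\<close>

lemma longest_intersect:
  assumes "longest p" "longest q"
  shows "set p \<inter> set q \<noteq> {}"
proof
  assume disj: "set p \<inter> set q = {}"
  define conn where "conn r \<longleftrightarrow> path r \<and> hd r \<in> set p \<and> last r \<in> set q" for r
  have "hd p \<in> set p" "hd q \<in> set q"
    using assms longest_nonempty by auto
  then have "hd p \<in> V" "hd q \<in> V"
    using assms longest_subset by blast+
  then obtain r0 where "conn r0"
    using linked[of "hd p" "hd q"] \<open>hd p \<in> set p\<close> \<open>hd q \<in> set q\<close>
    unfolding conn_def path_def by metis
  then obtain r where r: "conn r" and minimal: "\<And>r'. conn r' \<Longrightarrow> length r \<le> length r'"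
    using ex_has_least_nat[of conn r0 length] by metis
  have "path r" "r \<noteq> []" "hd r \<noteq> last r"
    using r disj unfolding conn_def path_def by auto
  then obtain m where m: "r = hd r # m @ [last r]"
    by (cases r; cases "tl r" rule: rev_cases) auto
  \<comment> \<open>An inner vertex on \<open>p\<close>, or below on \<open>q\<close>, would give a
    shorter connection.\<close>
  have "set m \<inter> set p = {}"
  proof (rule ccontr)
    assume "set m \<inter> set p \<noteq> {}"
    then obtain x m1 m2 where x: "x \<in> set p" "m = m1 @ x # m2"
      by (meson disjoint_iff split_list)
    then have "conn (x # m2 @ [last r])"
      using r path_appendD2[of "hd r # m1" "x # m2 @ [last r]"] m \<open>path r\<close>
      unfolding conn_def by auto
    from minimal[OF this] show False
      using arg_cong[OF m, of length] x by simp
  qed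
  have "set m \<inter> set q = {}"
  proof (rule ccontr)
    assume "set m \<inter> set q \<noteq> {}"
    then obtain x m1 m2 where x: "x \<in> set q" "m = m1 @ x # m2"
      by (meson disjoint_iff split_list)
    then have "conn (hd r # m1 @ [x])"
      using r path_appendD1[of "hd r # m1 @ [x]" "m2 @ [last r]"] m \<open>path r\<close>
      unfolding conn_def by auto
    from minimal[OF this] show False
      using arg_cong[OF m, of length] x by simp
  qed
  obtain p' where p': "path p'" "last p' = hd r" "set p' \<subseteq> set p" "length p < 2 * length p'"
    using half_path r longest_path[OF assms(1)] unfolding conn_def by metis
  obtain q' where q': "path q'" "last q' = last r" "set q' \<subseteq> set q" "length q < 2 * length q'"
    using half_path r longest_path[OF assms(2)] unfolding conn_def by metis
  have "q' \<noteq> []" "p' \<noteq> []"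
    using p' q' by (auto simp: path_def)
  \<comment> \<open>Stating the head as that of \<open>m @ [last r]\<close> covers the case
    \<open>m = []\<close>, where \<open>rev q'\<close> itself starts with
    \<open>last r\<close>.\<close>
  have "path (m @ rev q') \<and> hd (m @ rev q') = hd (m @ [last r])"
  proof (cases "m = []")
    case False
    have "E (last m) (last r)"
      using path_adj[of "hd r # m" "[last r]"] \<open>path r\<close> m False by simp
    moreover have "path m"
      using path_appendD2[of "[hd r]" "m @ [last r]"] path_appendD1[of m "[last r]"] \<open>path r\<close> m False
      by simp
    ultimately show ?thesis
      using q' False \<open>set m \<inter> set q = {}\<close> by (auto intro!: path_append simp: hd_rev)
  qed (use q' in \<open>simp add: hd_rev\<close>)
  moreover have "E (hd r) (hd (m @ [last r]))"
    using path_adj[of "[hd r]" "m @ [last r]"] \<open>path r\<close> m by simp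
  ultimately have "path (p' @ m @ rev q')"
    using p' q' disj \<open>set m \<inter> set p = {}\<close> by - (rule path_append, auto)
  moreover have "length p = length q"
    using assms by (simp add: longest_def le_antisym)
  ultimately show False
    using longest_length[OF assms(1), of "p' @ m @ rev q'"] p' q' by simp
qed

end

section \<open>Intersection graphs of subtrees of a spider\<close>

text \<open>The host tree enters through its centre \<open>c\<close>, the \<open>leg\<close> of each other node and the distance
  \<open>\<delta>\<close> from \<open>c\<close>; \<open>S u\<close> is the vertex set of the subtree of \<open>u\<close>.\<close>

locale spider_intersection_graph = connected_simple_graph V E
  for V :: "'a set" and E +
  fixes S :: "'a \<Rightarrow> 'b set" and N :: "'b set" and c :: 'b and leg :: "'b \<Rightarrow> 'c" and \<delta> :: "'b \<Rightarrow> nat"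
  assumes V_nonempty: "V \<noteq> {}"
    and S_subset: "u \<in> V \<Longrightarrow> S u \<subseteq> N"
    and S_nonempty: "u \<in> V \<Longrightarrow> S u \<noteq> {}"
    and E_iff: "\<lbrakk>u \<in> V; v \<in> V\<rbrakk> \<Longrightarrow> E u v \<longleftrightarrow> u \<noteq> v \<and> S u \<inter> S v \<noteq> {}"
    and finite_N: "finite N"
    and coords_inj: "\<lbrakk>x \<in> N; y \<in> N; x \<noteq> c; y \<noteq> c; leg x = leg y; \<delta> x = \<delta> y\<rbrakk> \<Longrightarrow> x = y"
    and S_leg: "\<lbrakk>u \<in> V; c \<notin> S u; x \<in> S u; y \<in> S u\<rbrakk> \<Longrightarrow> leg x = leg y"
    and S_separated: "\<lbrakk>u \<in> V; t \<in> N; t \<noteq> c; x \<in> S u; x \<noteq> c; leg x = leg t; \<delta> t \<le> \<delta> x;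
      y \<in> S u; y = c \<or> leg y \<noteq> leg t \<or> \<delta> y < \<delta> t\<rbrakk> \<Longrightarrow> t \<in> S u"
begin

lemma bag_clique: "\<lbrakk>u \<in> V; v \<in> V; t \<in> S u; t \<in> S v; u \<noteq> v\<rbrakk> \<Longrightarrow> E u v"
  using E_iff by blast

lemma E_common:
  assumes "E u v"
  obtains t where "t \<in> S u" "t \<in> S v"
  using assms E_iff E_in_V E_sym by (metis disjoint_iff)

text \<open>Along a leg, subtrees through a fixed node have nested traces; this picks a largest one.\<close>

lemma furthest:
  assumes "u0 \<in> V" "t \<in> S u0" "z0 \<in> S u0" "z0 \<noteq> c"
  obtains v where "v \<in> V" "t \<in> S v"
    "\<And>u y. \<lbrakk>u \<in> V; t \<in> S u; y \<in> S u; y \<noteq> c; leg y = leg z0;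
       t = c \<or> leg t = leg z0 \<and> \<delta> t \<le> \<delta> y\<rbrakk> \<Longrightarrow> y \<in> S v"
proof -
  \<comment> \<open>The nodes of the chosen leg reached by subtrees through \<open>t\<close>;
    \<open>v\<close> will be an owner of a deepest one.\<close>
  define Z where "Z = {z. z \<noteq> c \<and> leg z = leg z0 \<and> (\<exists>u\<in>V. t \<in> S u \<and> z \<in> S u)}"
  have "finite Z" "Z \<noteq> {}"
    using assms S_subset finite_N unfolding Z_def by (auto elim!: finite_subset[rotated])
  then obtain z where z: "z \<in> Z" "\<And>y. y \<in> Z \<Longrightarrow> \<delta> y \<le> \<delta> z"
    using finite_maximizer[of Z \<delta>] by blast
  then obtain v where v: "v \<in> V" "t \<in> S v" "z \<in> S v" "z \<noteq> c" "leg z = leg z0"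
    unfolding Z_def by blast
  have "y \<in> S v" if y: "u \<in> V" "t \<in> S u" "y \<in> S u" "y \<noteq> c" "leg y = leg z0"
    "t = c \<or> leg t = leg z0 \<and> \<delta> t \<le> \<delta> y" for u y
  proof (cases "y = t")
    case False
    have "y \<in> N" "t \<in> N" using y S_subset by auto
    \<comment> \<open>By injectivity of the coordinates \<open>y\<close> lies strictly beyond
      \<open>t\<close>. It separates \<open>t\<close> from \<open>z\<close>, so
      \<open>S_separated\<close>, the convexity of subtrees, puts it into
      \<open>S v\<close>.\<close>
    then have "t = c \<or> \<delta> t < \<delta> y"
      using coords_inj[of y t] y False by fastforce
    moreover have "\<delta> y \<le> \<delta> z"
      using y by (intro z(2)) (auto simp: Z_def)
    ultimately show ?thesis
      using S_separated[of v y z t] v y \<open>y \<in> N\<close> by auto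
  qed (use v in simp)
  then show thesis using that v by blast
qed

text \<open>A subtree missing \<open>c\<close> stays in one leg, and adjacent vertices share a node,
  so the leg is inherited along the path.\<close>

lemma path_avoiding_centre:
  assumes "path p" "a \<in> set p" "x \<in> S a" "\<And>u. u \<in> set p \<Longrightarrow> c \<notin> S u"
    and "b \<in> set p" "y \<in> S b"
  shows "leg y = leg x"
proof -
  have V: "u \<in> V" if "u \<in> set p" for u
    using assms(1) that by (auto simp: path_def)
  have "\<forall>y\<in>S b. leg y = leg x"
  proof (rule path_invariant[where a = a and p = p])
    show "\<forall>y\<in>S a. leg y = leg x"
      using S_leg[of a] assms V by blast
    fix u w assume uw: "u \<in> set p" "w \<in> set p" "E u w" "\<forall>y\<in>S u. leg y = leg x"
    then show "\<forall>y\<in>S w. leg y = leg x"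
      using E_common[of u w] S_leg[of w] assms(4) V by metis
  qed (use assms in auto)
  then show ?thesis using assms by blast
qed

text \<open>If a longest path misses the bag of \<open>c\<close>, it lies in one leg. Among those paths take one whose
  node \<open>t\<close> closest to \<open>c\<close> is as far from \<open>c\<close> as possible; all longest paths then meet the bag
  of \<open>t\<close>.\<close>

lemma common_vertex_off_centre:
  assumes "longest p0" "\<And>u. u \<in> set p0 \<Longrightarrow> c \<notin> S u"
  shows "\<exists>v\<in>V. \<forall>p. longest p \<longrightarrow> v \<in> set p"
proof -
  define off where "off p \<longleftrightarrow> longest p \<and> (\<forall>u\<in>set p. c \<notin> S u)" for p
  define lowest where "lowest p t \<longleftrightarrow>
    (\<exists>u\<in>set p. t \<in> S u) \<and> (\<forall>u\<in>set p. \<forall>x\<in>S u. \<delta> t \<le> \<delta> x)" for p t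
  have lowest_ex: "\<exists>t. lowest p t" if "off p" for p
  proof -
    let ?X = "\<Union>u\<in>set p. S u"
    have "set p \<subseteq> V" "p \<noteq> []"
      using that longest_subset longest_nonempty unfolding off_def by auto
    then have "finite ?X" "?X \<noteq> {}"
      using finite_N S_subset S_nonempty
      by (auto intro: finite_subset[of _ N]) (metis S_nonempty hd_in_set subsetD)
    then show ?thesis
      using finite_minimizer[of ?X \<delta>] unfolding lowest_def by (metis UN_E UN_I)
  qed
  define T where "T = {t. \<exists>p. off p \<and> lowest p t}"
  have "T \<subseteq> N"
    using S_subset longest_subset unfolding T_def off_def lowest_def by blast
  then have "finite T"
    using finite_N finite_subset by blast
  moreover have "T \<noteq> {}"
    using lowest_ex[of p0] assms unfolding T_def off_def by blast
  ultimately obtain t where "t \<in> T" and t_max: "\<And>t'. t' \<in> T \<Longrightarrow> \<delta> t' \<le> \<delta> t"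
    using finite_maximizer[of T \<delta>] by blast
  then obtain p where p: "off p" "lowest p t"
    unfolding T_def by blast
  have "t \<in> N" using \<open>t \<in> T\<close> \<open>T \<subseteq> N\<close> by blast
  obtain u0 where u0: "u0 \<in> set p" "t \<in> S u0"
    using p(2) unfolding lowest_def by blast
  have "t \<noteq> c" "u0 \<in> V"
    using p(1) u0 longest_subset unfolding off_def by auto
  define outer where "outer w \<longleftrightarrow> (\<forall>y\<in>S w. y \<noteq> c \<and> leg y = leg t \<and> \<delta> t \<le> \<delta> y)" for w
  have p_outer: "outer w" if "w \<in> set p" for w
    unfolding outer_def
    using path_avoiding_centre[of p u0 t] p u0 that longest_path
    unfolding off_def lowest_def by blast
  \<comment> \<open>By convexity, a subtree with nodes both in the part of the leg from
    \<open>t\<close> outwards and off it passes through \<open>t\<close>.\<close>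
  have not_outer: "outer w \<or> t \<in> S w \<or> (\<forall>y\<in>S w. \<not> (y \<noteq> c \<and> leg y = leg t \<and> \<delta> t \<le> \<delta> y))"
    if "w \<in> V" for w
    using S_separated[OF that \<open>t \<in> N\<close> \<open>t \<noteq> c\<close>] unfolding outer_def by (metis not_le)
  \<comment> \<open>Here \<open>t\<close> is both the fixed node and the node naming the leg in
    \<open>furthest\<close>.\<close>
  obtain v where v: "v \<in> V" "t \<in> S v"
    and far: "\<And>u y. \<lbrakk>u \<in> V; t \<in> S u; y \<in> S u; y \<noteq> c; leg y = leg t; \<delta> t \<le> \<delta> y\<rbrakk> \<Longrightarrow> y \<in> S v"
    using furthest[OF \<open>u0 \<in> V\<close> u0(2) u0(2) \<open>t \<noteq> c\<close>] by metis
  have "v \<in> set q" if q: "longest q" for q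
  proof (rule ccontr)
    assume "v \<notin> set q"
    have qV: "w \<in> V" if "w \<in> set q" for w
      using longest_subset q that by blast
    obtain x where x: "x \<in> set p" "x \<in> set q"
      using longest_intersect[of p q] p q unfolding off_def by blast
    \<comment> \<open>If \<open>q\<close> missed the bag of \<open>t\<close>, \<open>outer\<close>
      would spread from \<open>x\<close> along all of \<open>q\<close>. Maximality of
      \<open>t\<close> would then make \<open>t\<close> itself the lowest node of
      \<open>q\<close>.\<close>
    have meets: "\<exists>u\<in>set q. t \<in> S u"
    proof (rule ccontr)
      assume none: "\<not> ?thesis"
      have q_outer: "outer w" if "w \<in> set q" for w
      proof (rule path_invariant[where a = x and p = q])
        fix a b assume ab: "a \<in> set q" "b \<in> set q" "E a b" "outer a"
        obtain y where y: "y \<in> S a" "y \<in> S b" using E_common ab by blast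
        then have "y \<noteq> c \<and> leg y = leg t \<and> \<delta> t \<le> \<delta> y"
          using ab(4) unfolding outer_def by blast
        then show "outer b"
          using not_outer[of b] y ab none qV by blast
      qed (use q x p_outer that longest_path in auto)
      then have "off q"
        using q unfolding off_def outer_def by blast
      then obtain t' where t': "lowest q t'"
        using lowest_ex by blast
      then have "\<delta> t' \<le> \<delta> t"
        using t_max \<open>off q\<close> unfolding T_def by blast
      moreover obtain u where u: "u \<in> set q" "t' \<in> S u"
        using t' unfolding lowest_def by blast
      moreover from this have "t' \<noteq> c" "leg t' = leg t" "\<delta> t \<le> \<delta> t'" "t' \<in> N"
        using q_outer S_subset qV unfolding outer_def by blast+
      ultimately have "t' = t"
        using coords_inj \<open>t \<in> N\<close> \<open>t \<noteq> c\<close> by auto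
      then show False using none u by blast
    qed
    then obtain u where u: "u \<in> set q" "t \<in> S u" by blast
    \<comment> \<open>Moving along \<open>q\<close> from \<open>w\<close> to \<open>u\<close>, some
      \<open>a\<close> strictly beyond \<open>t\<close> is next to some \<open>b\<close> through
      \<open>t\<close>. Their common node also lies in \<open>S v\<close>, so \<open>v\<close> would
      be adjacent to both.\<close>
    have no_strict: "t \<in> S w" if w: "w \<in> set q" "outer w" for w
    proof (rule ccontr)
      assume "t \<notin> S w"
      then obtain a b where ab: "a \<in> set q" "b \<in> set q" "E a b" "outer a \<and> t \<notin> S a"
        "\<not> (outer b \<and> t \<notin> S b)" "\<not> (E v a \<and> E v b)"
        using longest_switch[OF q \<open>v \<notin> set q\<close>, of w u "\<lambda>w. outer w \<and> t \<notin> S w"] w u by auto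
      obtain y where y: "y \<in> S a" "y \<in> S b" using E_common ab by blast
      then have y': "y \<noteq> c" "leg y = leg t" "\<delta> t \<le> \<delta> y"
        using ab(4) unfolding outer_def by blast+
      then have "t \<in> S b"
        using not_outer[of b] ab y qV by blast
      then have "y \<in> S v"
        using far[of b y] y y' qV ab by blast
      then have "E v a \<and> E v b"
        using bag_clique v y ab \<open>t \<in> S b\<close> qV \<open>v \<notin> set q\<close> by metis
      then show False using ab by blast
    qed
    \<comment> \<open>The shared vertex \<open>x\<close> now passes through \<open>t\<close>, and so
      does each of its neighbours on \<open>q\<close>; all of them are adjacent to \<open>v\<close>,
      against \<open>longest_neighbour\<close>.\<close>
    have "outer x" using x p_outer by blast
    then have "t \<in> S x" using no_strict x by blast
    then have "E v x"
      using bag_clique v x qV \<open>v \<notin> set q\<close> by metis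
    then obtain y where y: "y \<in> set q" "E x y" "\<not> E v y"
      using longest_neighbour[OF q \<open>v \<notin> set q\<close> x(2)] by blast
    obtain z where z: "z \<in> S x" "z \<in> S y" using E_common y by blast
    then have "t \<in> S y"
      using \<open>outer x\<close> not_outer[of y] no_strict[of y] y(1) qV unfolding outer_def by blast
    then show False
      using bag_clique v y qV \<open>v \<notin> set q\<close> by metis
  qed
  then show ?thesis using v by blast
qed

text \<open>Otherwise take a longest path \<open>e\<close> in the complement of the central bag that starts next to that
  bag, and let \<open>v\<close> be the central vertex reaching furthest into the leg of \<open>e\<close>. A longest path
  avoiding \<open>v\<close> cannot enter that leg, so replacing its initial segment outside the central bag by
  \<open>rev e @ [v]\<close> would lengthen it.\<close>

lemma common_vertex_centre:
  assumes meet: "\<And>p. longest p \<Longrightarrow> \<exists>u\<in>set p. c \<in> S u"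
  shows "\<exists>v\<in>V. \<forall>p. longest p \<longrightarrow> v \<in> set p"
proof -
  \<comment> \<open>Tails are read from the centre outwards, so initial segments of longest paths
    appear reversed.\<close>
  define tail where "tail e \<longleftrightarrow> path e \<and> (\<forall>w\<in>set e. c \<notin> S w) \<and> (\<exists>u\<in>V. c \<in> S u \<and> E u (hd e))" for e
  have split: "\<exists>s u r. p = s @ u # r \<and> c \<in> S u \<and> tail (rev s)"
    if p: "longest p" "v \<in> V" "c \<in> S v" "v \<notin> set p" for p v
  proof -
    obtain s u r where sur: "p = s @ u # r" "c \<in> S u" "\<And>w. w \<in> set s \<Longrightarrow> c \<notin> S w"
      using split_list_first_prop[OF meet[OF p(1)]] by metis
    have V: "set p \<subseteq> V" using longest_subset p(1) .
    \<comment> \<open>Otherwise the central vertex \<open>u\<close> would be the head of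
      \<open>p\<close> and adjacent to the missing \<open>v\<close>.\<close>
    have "s \<noteq> []"
      using longest_hd[OF p(1,4)] bag_clique[of v u c] p sur V by auto
    moreover from this have "path s" "E (last s) u"
      using path_appendD1[of s "u # r"] path_adj[of s "u # r"] longest_path[OF p(1)] sur by auto
    ultimately have "tail (rev s)"
      unfolding tail_def using sur V E_sym by (auto simp: hd_rev)
    then show ?thesis using sur by blast
  qed
  obtain p0 where "longest p0"
    using longest_exists[OF V_nonempty] .
  then obtain c0 where c0: "c0 \<in> V" "c \<in> S c0"
    using meet[of p0] longest_subset[of p0] by blast
  show ?thesis
  proof (cases "\<exists>e. tail e")
    case False
    \<comment> \<open>Without tails \<open>split\<close> is contradictory, so any vertex of the
      central bag will do.\<close>
    then have "c0 \<in> set p" if "longest p" for p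
      using split[OF that c0] by blast
    then show ?thesis using c0 by blast
  next
    case True
    then obtain e0 where "tail e0" by blast
    moreover have "\<forall>e. tail e \<longrightarrow> length e < Suc (card V)"
      using path_length_le unfolding tail_def by (simp add: less_Suc_eq_le)
    ultimately obtain e where e: "tail e" and e_max: "\<And>e'. tail e' \<Longrightarrow> length e' \<le> length e"
      using ex_has_greatest_nat[of tail e0 length "Suc (card V)"] by blast
    then obtain u0 where u0: "u0 \<in> V" "c \<in> S u0" "E u0 (hd e)"
      unfolding tail_def by blast
    have "path e" "hd e \<in> set e" "hd e \<in> V"
      using e unfolding tail_def path_def by auto
    \<comment> \<open>This node determines the leg that contains \<open>e\<close>.\<close>
    obtain z0 where z0: "z0 \<in> S u0" "z0 \<in> S (hd e)"
      using E_common u0 by blast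
    have "z0 \<noteq> c"
      using e z0 \<open>hd e \<in> set e\<close> unfolding tail_def by blast
    obtain v where v: "v \<in> V" "c \<in> S v"
      and far: "\<And>u y. \<lbrakk>u \<in> V; c \<in> S u; y \<in> S u; y \<noteq> c; leg y = leg z0\<rbrakk> \<Longrightarrow> y \<in> S v"
      using furthest[OF u0(1,2) z0(1) \<open>z0 \<noteq> c\<close>] by metis
    define inside where "inside w \<longleftrightarrow> (\<forall>y\<in>S w. y \<noteq> c \<and> leg y = leg z0)" for w
    have e_inside: "inside w" if "w \<in> set e" for w
      using path_avoiding_centre[of e "hd e" z0 w] e \<open>path e\<close> \<open>hd e \<in> set e\<close> z0 that
      unfolding tail_def inside_def by metis
    have "v \<in> set p" if p: "longest p" for p
    proof (rule ccontr)
      assume "v \<notin> set p"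
      obtain s u r where sur: "p = s @ u # r" "c \<in> S u" "tail (rev s)"
        using split[OF p v \<open>v \<notin> set p\<close>] by blast
      have pV: "w \<in> V" if "w \<in> set p" for w
        using longest_subset p that by blast
      \<comment> \<open>Going from \<open>w\<close> to the central \<open>u\<close>, the property
        \<open>inside\<close> is lost between some \<open>a\<close> and \<open>b\<close>. Then
        \<open>b\<close> contains \<open>c\<close> and shares a node of the leg with
        \<open>a\<close>; \<open>v\<close> covers both nodes and would be adjacent to both
        vertices.\<close>
      have "\<not> inside w" if w: "w \<in> set p" for w
      proof
        assume "inside w"
        moreover have "\<not> inside u" using sur unfolding inside_def by blast
        moreover have "u \<in> set p" using sur by simp
        ultimately obtain a b where ab: "a \<in> set p" "b \<in> set p" "E a b" "inside a" "\<not> inside b"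
          "\<not> (E v a \<and> E v b)"
          using longest_switch[OF p \<open>v \<notin> set p\<close> w, of u inside] by metis
        obtain y where y: "y \<in> S a" "y \<in> S b" using E_common ab by blast
        then have y': "y \<noteq> c" "leg y = leg z0"
          using ab(4) unfolding inside_def by blast+
        have "c \<in> S b"
          using ab(5) S_leg[of b _ y] y y' pV ab(2) unfolding inside_def by metis
        then have "y \<in> S v"
          using far y y' pV ab by blast
        then have "E v a \<and> E v b"
          using bag_clique v y ab pV \<open>v \<notin> set p\<close> by metis
        then show False using ab by blast
      qed
      then have disj: "set e \<inter> set p = {}"
        using e_inside by blast
      have "v \<notin> set e"
        using e_inside v unfolding inside_def by blast
      \<comment> \<open>Since \<open>u0\<close> reaches \<open>z0\<close> from the centre, so does
        \<open>v\<close>; hence \<open>e\<close> can be attached to \<open>v\<close>.\<close>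
      have "z0 \<in> S v"
        using far u0 z0 \<open>z0 \<noteq> c\<close> by blast
      then have "E v (hd e)"
        using bag_clique[of v "hd e" z0] v z0 \<open>hd e \<in> V\<close> \<open>hd e \<in> set e\<close> \<open>v \<notin> set e\<close> by metis
      have "path (u # r)"
        using path_appendD2[of s "u # r"] longest_path[OF p] sur by simp
      moreover have "E v u"
        using bag_clique[of v u c] v sur pV \<open>v \<notin> set p\<close> by auto
      ultimately have "path (v # u # r)"
        using \<open>v \<notin> set p\<close> sur by - (rule path_Cons, auto)
      then have "path (rev e @ v # u # r)"
        using \<open>path e\<close> disj \<open>v \<notin> set e\<close> E_sym[OF \<open>E v (hd e)\<close>] sur
        by - (rule path_append, auto simp: last_rev)
      \<comment> \<open>\<open>e\<close> is at least as long as \<open>s\<close>, and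
        \<open>v\<close> is the additional vertex.\<close>
      from longest_length[OF p this] show False
        using e_max[OF sur(3)] sur(1) by simp
    qed
    then show ?thesis using v by blast
  qed
qed

theorem common_vertex: "\<exists>v\<in>V. \<forall>p. longest p \<longrightarrow> v \<in> set p"
  using common_vertex_off_centre common_vertex_centre by blast

end

section \<open>Coordinates on subdivided stars\<close>

text \<open>Polar coordinates, in a form that survives subdividing one edge. Legs are named by
  nodes, and the leg of \<open>c\<close> is arbitrary.\<close>

definition spider_coords :: "'b pair_pre_digraph \<Rightarrow> 'b \<Rightarrow> ('b \<Rightarrow> 'b) \<Rightarrow> ('b \<Rightarrow> nat) \<Rightarrow> bool" where
  "spider_coords T c leg \<delta> \<longleftrightarrow> c \<in> pverts T \<and>
     (\<forall>x\<in>pverts T. \<delta> x = 0 \<longleftrightarrow> x = c) \<and>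
     (\<forall>x\<in>pverts T. \<forall>y\<in>pverts T. x \<noteq> c \<and> y \<noteq> c \<and> leg x = leg y \<and> \<delta> x = \<delta> y \<longrightarrow> x = y) \<and>
     (\<forall>(x, y)\<in>parcs T. x \<in> pverts T \<and> y \<in> pverts T \<and> (x = c \<or> y = c \<or> leg x = leg y) \<and>
        (\<delta> x = Suc (\<delta> y) \<or> \<delta> y = Suc (\<delta> x)))"

lemma spider_coordsD:
  assumes "spider_coords T c leg \<delta>"
  shows "c \<in> pverts T"
    and "x \<in> pverts T \<Longrightarrow> \<delta> x = 0 \<longleftrightarrow> x = c"
    and "\<lbrakk>x \<in> pverts T; y \<in> pverts T; x \<noteq> c; y \<noteq> c; leg x = leg y; \<delta> x = \<delta> y\<rbrakk> \<Longrightarrow> x = y"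
    and "(x, y) \<in> parcs T \<Longrightarrow> x \<in> pverts T \<and> y \<in> pverts T \<and>
      (x = c \<or> y = c \<or> leg x = leg y) \<and> (\<delta> x = Suc (\<delta> y) \<or> \<delta> y = Suc (\<delta> x))"
proof -
  note co = conjunct2[OF assms[unfolded spider_coords_def]]
  show "c \<in> pverts T"
    using assms unfolding spider_coords_def by (rule conjunct1)
  show "x \<in> pverts T \<Longrightarrow> \<delta> x = 0 \<longleftrightarrow> x = c"
    using bspec[OF conjunct1[OF co]] .
  show "\<lbrakk>x \<in> pverts T; y \<in> pverts T; x \<noteq> c; y \<noteq> c; leg x = leg y; \<delta> x = \<delta> y\<rbrakk> \<Longrightarrow> x = y"
    using co by blast
  show "(x, y) \<in> parcs T \<Longrightarrow> x \<in> pverts T \<and> y \<in> pverts T \<and>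
      (x = c \<or> y = c \<or> leg x = leg y) \<and> (\<delta> x = Suc (\<delta> y) \<or> \<delta> y = Suc (\<delta> x))"
    using bspec[OF conjunct2[OF conjunct2[OF co]], of "(x, y)"] by simp
qed

lemma spider_coords_star:
  assumes "star_graph K"
  shows "\<exists>c leg \<delta>. spider_coords K c leg \<delta>"
proof -
  obtain A B where K: "pverts K = A \<union> B" "A \<inter> B = {}" "card A = 1" "parcs K = A \<times> B \<union> B \<times> A"
    using assms unfolding star_graph_def complete_bipartite_digraph_pair_def by blast
  then obtain c where "A = {c}"
    using card_1_singletonE by blast
  \<comment> \<open>Each leaf is a leg of its own, named by itself.\<close>
  then have "spider_coords K c id (\<lambda>x. if x = c then 0 else 1)"
    using K unfolding spider_coords_def by auto
  then show ?thesis by blast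
qed

text \<open>With \<open>a\<close> the outer end, \<open>w\<close> takes over the coordinates of
  \<open>a\<close>, and the leg from \<open>a\<close> outwards moves one step away from the
  centre.\<close>

lemma spider_coords_subdivide:
  assumes co: "spider_coords T c leg \<delta>"
    and arc: "(a, b) \<in> parcs T" "\<delta> a = Suc (\<delta> b)" and w: "w \<notin> pverts T"
    and H: "pverts H = insert w (pverts T)"
      "parcs H \<subseteq> (parcs T - {(a, b), (b, a)}) \<union> {(a, w), (w, a), (w, b), (b, w)}"
  shows "\<exists>c leg \<delta>. spider_coords H c leg \<delta>"
proof -
  note zero = spider_coordsD(2)[OF co] and inj = spider_coordsD(3)[OF co]
    and arcs = spider_coordsD(4)[OF co]
  have zero_c: "\<delta> c = 0"
    using zero spider_coordsD(1)[OF co] by blast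
  have ab: "a \<in> pverts T" "b \<in> pverts T" "b = c \<or> leg a = leg b" "a \<noteq> c" "a \<noteq> w" "b \<noteq> w"
    using arcs[OF arc(1)] arc(2) zero[of a] zero[of b] w by auto
  define leg' where "leg' = leg(w := leg a)"
  define shift where "shift x \<longleftrightarrow> x \<noteq> c \<and> leg x = leg a \<and> \<delta> a \<le> \<delta> x" for x
  define \<delta>' where "\<delta>' x = (if x = w then \<delta> a else if shift x then Suc (\<delta> x) else \<delta> x)" for x
  have "\<forall>x\<in>pverts H. \<delta>' x = 0 \<longleftrightarrow> x = c"
    using H zero ab w spider_coordsD(1)[OF co] unfolding \<delta>'_def shift_def by auto
  moreover have "x = y" if "x \<in> pverts H" "y \<in> pverts H" "x \<noteq> c" "y \<noteq> c" "leg' x = leg' y"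
    "\<delta>' x = \<delta>' y" for x y
    using that inj[of x y] H unfolding \<delta>'_def leg'_def shift_def by (auto split: if_splits)
  moreover have old: "\<delta>' x = Suc (\<delta>' y)"
    if xy: "(x, y) \<in> parcs T \<or> (y, x) \<in> parcs T" "(x, y) \<noteq> (a, b)" "\<delta> x = Suc (\<delta> y)" for x y
  proof -
    have V: "x \<in> pverts T" "y \<in> pverts T" "y = c \<or> leg x = leg y" "x \<noteq> c"
      using arcs[of x y] arcs[of y x] xy zero_c by auto
    have "shift x \<longleftrightarrow> shift y"
    \<comment> \<open>An arc with just one shifted end crosses the threshold
      \<open>\<delta> a\<close> on the leg of \<open>a\<close>; by injectivity it is
      \<open>(a, b)\<close>.\<close>
    proof (rule ccontr)
      assume *: "\<not> ?thesis"
      then have "leg x = leg a" "\<delta> x = \<delta> a"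
        using V xy(3) zero_c arc(2) unfolding shift_def by (auto simp: not_le)
      then have "x = a" using inj V ab by blast
      moreover have "\<delta> y = \<delta> b" using xy(3) arc(2) \<open>\<delta> x = \<delta> a\<close> by simp
      \<comment> \<open>\<open>b\<close> may be the centre; then depth zero identifies
        \<open>y\<close>.\<close>
      then have "y = b"
        using inj[of y b] zero[of y] zero[of b] V ab \<open>leg x = leg a\<close> by metis
      ultimately show False using xy(2) by simp
    qed
    then show ?thesis using V w xy(3) unfolding \<delta>'_def by auto
  qed
  have "\<delta>' a = Suc (\<delta>' w)" "\<delta>' w = Suc (\<delta>' b)"
    using ab arc(2) unfolding \<delta>'_def shift_def by auto
  have "x \<in> pverts H \<and> y \<in> pverts H \<and> (x = c \<or> y = c \<or> leg' x = leg' y) \<and>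
      (\<delta>' x = Suc (\<delta>' y) \<or> \<delta>' y = Suc (\<delta>' x))" if "(x, y) \<in> parcs H" for x y
  proof (cases "(x, y) \<in> parcs T - {(a, b), (b, a)}")
    case True
    then have "x \<noteq> w" "y \<noteq> w" using arcs w by auto
    moreover have "(x, y) \<noteq> (a, b)" "(y, x) \<noteq> (a, b)" using True by auto
    ultimately show ?thesis
      using arcs[of x y] True old[of x y] old[of y x] H unfolding leg'_def by auto
  next
    case False
    then have "(x, y) \<in> {(a, w), (w, a), (w, b), (b, w)}" using that H by blast
    then show ?thesis
      using ab H \<open>\<delta>' a = Suc (\<delta>' w)\<close> \<open>\<delta>' w = Suc (\<delta>' b)\<close> unfolding leg'_def by auto
  qed
  moreover have "c \<in> pverts H"
    using spider_coordsD(1)[OF co] H by simp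
  ultimately have "spider_coords H c leg' \<delta>'"
    unfolding spider_coords_def by blast
  then show ?thesis by blast
qed

text \<open>Induction over the subdivisions; by symmetry each divided edge can be directed towards
  the centre.\<close>

lemma spider_coords_subdivision:
  assumes "subdivision_pair K T" "\<exists>c leg \<delta>. spider_coords K c leg \<delta>"
  shows "\<exists>c leg \<delta>. spider_coords T c leg \<delta>"
  using assms
proof (induction rule: subdivision_pair_induct)
  case (divide e w H)
  obtain u v where e: "e = (u, v)" by (cases e)
  obtain c leg \<delta> where co: "spider_coords H c leg \<delta>"
    using divide by blast
  interpret H: pair_bidirected_digraph H
    using divide.hyps(3) by (rule bidirected_digraphI_subdivision)
  have uv: "(u, v) \<in> parcs H" "(v, u) \<in> parcs H"
    using divide.hyps(1) e H.arcs_symmetric by auto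
  then consider "\<delta> u = Suc (\<delta> v)" | "\<delta> v = Suc (\<delta> u)"
    using spider_coordsD(4)[OF co] by blast
  then show ?case
  proof cases
    case 1
    show ?thesis
      by (rule spider_coords_subdivide[OF co uv(1) 1 divide.hyps(2)]) (auto simp: e subdivide.simps)
  next
    case 2
    show ?thesis
      by (rule spider_coords_subdivide[OF co uv(2) 2 divide.hyps(2)]) (auto simp: e subdivide.simps)
  qed
qed

section \<open>From tree representations to the spider model\<close>

text \<open>Otherwise \<open>P\<close> would spread along a walk from \<open>x\<close> to
  \<open>y\<close>. As \<open>H\<close> is symmetric, connectedness gives reachability in
  \<open>H\<close> itself.\<close>

lemma connected_crossing_arc:
  assumes "pair_graph H" "connected (with_proj H)" "x \<in> pverts H" "y \<in> pverts H" "P x" "\<not> P y"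
  obtains a b where "(a, b) \<in> parcs H" "P a" "\<not> P b"
proof -
  interpret pair_graph H by fact
  have "x \<rightarrow>\<^sup>*\<^bsub>with_proj H\<^esub> y"
    using assms(2-4) reachable_mk_symmetric_eq[OF pair_sym_arcs]
    unfolding connected_def strongly_connected_def by (simp add: mk_symmetric_def)
  then have "P y \<or> (\<exists>a b. (a, b) \<in> parcs H \<and> P a \<and> \<not> P b)"
    by (induction rule: reachable_induct) (use assms(5) in auto)
  then show thesis using assms(6) that by blast
qed

lemma successively_vwalk_arcs:
  "successively (\<lambda>u v. (u, v) \<in> A) p \<longleftrightarrow> set (vwalk_arcs p) \<subseteq> A"
  by (induction p rule: vwalk_arcs.induct) auto

theorem corollary5p8:
  shows "gallai {G :: 'a pair_pre_digraph.
           pair_graph G \<and> connected (with_proj G) \<and> chordal G \<and>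
           (\<exists>(T :: 'b pair_pre_digraph) S. tree_representation G T S \<and> subdivided_star T)}"
  unfolding gallai_def
proof (intro ballI impI)
  fix G :: "'a pair_pre_digraph"
  assume "G \<in> {G. pair_graph G \<and> connected (with_proj G) \<and> chordal G \<and>
    (\<exists>(T :: 'b pair_pre_digraph) S. tree_representation G T S \<and> subdivided_star T)}"
  then obtain T :: "'b pair_pre_digraph" and S
    where G: "pair_graph G" "connected (with_proj G)"
      and rep: "tree_representation G T S" and star: "subdivided_star T"
    by blast
  interpret G: pair_graph G by fact
  interpret T: pair_graph T
    using rep unfolding tree_representation_def tree_graph_def by blast
  obtain c leg \<delta> where co: "spider_coords T c leg \<delta>"
    using star spider_coords_star spider_coords_subdivision unfolding subdivided_star_def by metis
  note zero = spider_coordsD(2)[OF co] and inj = spider_coordsD(3)[OF co]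
    and arcs = spider_coordsD(4)[OF co]
  have sub: "pair_graph (S u)" "connected (with_proj (S u))" "pverts (S u) \<subseteq> pverts T"
    "parcs (S u) \<subseteq> parcs T" if "u \<in> pverts G" for u
    using rep that unfolding tree_representation_def subtree_def tree_graph_def
    by (auto simp: subgraph_def)
  \<comment> \<open>This form of connectedness of the subtrees yields both \<open>S_leg\<close> and
    \<open>S_separated\<close> below.\<close>
  have crossing: "\<exists>a b. (a, b) \<in> parcs T \<and> a \<in> pverts (S u) \<and> b \<in> pverts (S u) \<and> P a \<and> \<not> P b"
    if u: "u \<in> pverts G" "x \<in> pverts (S u)" "y \<in> pverts (S u)" "P x" "\<not> P y" for u x y P
  proof -
    interpret Su: pair_graph "S u" using sub u by blast
    show ?thesis
      using connected_crossing_arc[of "S u" x y P] sub[of u] u Su.wellformed' by (metis subsetD)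
  qed
  interpret spider_intersection_graph "pverts G" "\<lambda>u v. (u, v) \<in> parcs G"
    "\<lambda>u. pverts (S u)" "pverts T" c leg \<delta>
  proof
    fix u v assume uv: "u \<in> pverts G" "v \<in> pverts G"
    show "((u, v) \<in> parcs G) = (u \<noteq> v \<and> pverts (S u) \<inter> pverts (S v) \<noteq> {})"
      using rep uv G.no_loops' unfolding tree_representation_def by metis
    have "u \<rightarrow>\<^sup>*\<^bsub>with_proj G\<^esub> v"
      using G(2) uv G.reachable_mk_symmetric_eq[OF G.pair_sym_arcs]
      unfolding connected_def strongly_connected_def by (simp add: mk_symmetric_def)
    then show "\<exists>p. p \<noteq> [] \<and> distinct p \<and> set p \<subseteq> pverts G \<and>
        successively (\<lambda>u v. (u, v) \<in> parcs G) p \<and> hd p = u \<and> last p = v"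
      unfolding G.reachable_vpath_conv vpath_def vwalk_def successively_vwalk_arcs by auto
  next
    fix u assume u: "u \<in> pverts G"
    show "pverts (S u) \<subseteq> pverts T" using sub u by blast
    show "pverts (S u) \<noteq> {}"
      using sub(2)[OF u] unfolding connected_def strongly_connected_def by (simp add: mk_symmetric_def)
  next
    fix u x y
    assume *: "u \<in> pverts G" "c \<notin> pverts (S u)" "x \<in> pverts (S u)" "y \<in> pverts (S u)"
    show "leg x = leg y"
      using crossing[of u x y "\<lambda>z. leg z = leg x"] * arcs by metis
  next
    fix u t x y
    assume *: "u \<in> pverts G" "t \<in> pverts T" "t \<noteq> c" "x \<in> pverts (S u)" "x \<noteq> c" "leg x = leg t"
      "\<delta> t \<le> \<delta> x" "y \<in> pverts (S u)" "y = c \<or> leg y \<noteq> leg t \<or> \<delta> y < \<delta> t"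
    then obtain a b where ab: "(a, b) \<in> parcs T" "a \<in> pverts (S u)"
      "a \<noteq> c \<and> leg a = leg t \<and> \<delta> t \<le> \<delta> a" "\<not> (b \<noteq> c \<and> leg b = leg t \<and> \<delta> t \<le> \<delta> b)"
      using crossing[of u x y "\<lambda>z. z \<noteq> c \<and> leg z = leg t \<and> \<delta> t \<le> \<delta> z"] by auto
    \<comment> \<open>Within a leg or towards \<open>c\<close>, the arc leaves the part beyond
      \<open>t\<close> only by dropping below depth \<open>\<delta> t\<close>. Depths change by one,
      so \<open>a\<close> has the coordinates of \<open>t\<close>.\<close>
    have "\<delta> t \<noteq> 0" using zero * by blast
    then have "\<delta> b < \<delta> t"
      using ab(3,4) arcs[OF ab(1)] zero[of b] by fastforce
    then have "\<delta> a = \<delta> t"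
      using ab(3) arcs[OF ab(1)] by linarith
    then show "t \<in> pverts (S u)"
      using inj[of a t] ab arcs[OF ab(1)] * by blast
  next
    show "pverts G \<noteq> {}"
      using G(2) unfolding connected_def strongly_connected_def by (simp add: mk_symmetric_def)
  qed (use inj G.arcs_symmetric G.wellformed' in \<open>auto simp: G.pair_finite_verts T.pair_finite_verts\<close>)
  have "path p \<longleftrightarrow> vpath p (with_proj G)" for p
    unfolding path_def vpath_def vwalk_def successively_vwalk_arcs by auto
  \<comment> \<open>\<open>vwalk_length\<close> is one less than \<open>length\<close>; the orders
    agree because paths are nonempty.\<close>
  then have "longest p" if "longest_path G p" for p
    using that path_def unfolding longest_path_def longest_def vwalk_length_simp
    by (metis One_nat_def Suc_le_mono Suc_pred length_greater_0_conv)
  then show "\<exists>v\<in>pverts G. \<forall>p. longest_path G p \<longrightarrow> v \<in> set p"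
    using common_vertex by blast
qed

end
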